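(* Let $G$ be a $\Delta$-groupoid with distinguished generating set $H$. The group $B=\bigoplus_{n\in\mathbb{Z}}B_n$ is a chain complex with differential $\partial=\sum_{i\ge0}(-1)^i\partial_i$ (so $\partial B_n\subset B_{n-1}$ and $\partial^2=0$) and grading operator $p\colon B\to B$, $p|_{B_n}=n$.
   Context: $\Delta$-groupoid: a groupoid $G$ (identified with its set of morphisms; $(x,y)$ composable iff $\mathrm{cod}(x)=\mathrm{dom}(y)$, composite $xy$) with a generating subset $H\subset G$ (in particular every object is the domain of some element of $H$) and an involution $j\colon H\to H$ such that (i) $i(H)=H$ where $i(x)=x^{-1}$; (ii) $iji=jij$ on $H$; (iii) if $(x,y)\in H^2$ is composable then $(k(x),j(y))$ is composable, where $k=iji$; (iv) if $(x,y)\in H^2$ is $H$-composable (composable with $xy\in H$), then $(k(x),j(y))$ is $H$-composable and $k(xy)\,i(k(y))=k(k(x)j(y))$. For an object $A$, put $A^*=\mathrm{dom}(j(x))$ for any $x\in H$ with $\mathrm{dom}(x)=A$ (independent of $x$). For an $H$-composable pair put $x*y=j(k(x)j(y))=i(j(x))\,j(xy)$. Sets $V_n$: $V_{-1}=\{*\}$; $V_0=\pi_0(G)$ (connected components); $V_1=\mathrm{Ob}(G)$; $V_2=H$; $V_3$ is the set of $H$-composable pairs; for $n>2$, $V_{n+1}$ is the set of $(x_1,\dots,x_n)\in H^n$ with $(x_i,x_{i+1})\in V_3$ for $1\le i\le n-1$ and $\partial_i(x_1,\dots,x_n)\in V_n$ for $1\le i\le n+1$. Maps $\partial_i\colon V_{n+1}\to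 V_n$ for $n\ge2$, $0\le i\le n+1$: $\partial_1(x_1,\dots,x_n)=(x_2,\dots,x_n)$; $\partial_i(x_1,\dots,x_n)=(x_1,\dots,x_{i-2},x_{i-1}x_i,x_{i+1},\dots,x_n)$ for $2\le i\le n$; $\partial_{n+1}(x_1,\dots,x_n)=(x_1,\dots,x_{n-1})$; $\partial_0(x_1,\dots,x_n)=(y_1,\dots,y_{n-1})$ with $y_i=z_i*x_{i+1}$, $z_i=x_1x_2\cdots x_i$ (this lies in $V_n$). In low degrees: $\partial_0\colon V_0\to V_{-1}$ is the unique map; for $A\in V_1$, $\partial_0A=[A^*]$, $\partial_1A=[A]$ ($[A]$ the connected component of $A$); for $x\in V_2$, $\partial_0x=\mathrm{cod}(j(x))$, $\partial_1x=\mathrm{cod}(x)$, $\partial_2x=\mathrm{dom}(x)$. $B_n=\mathbb{Z}V_n$ is the free abelian group on $V_n$ for $n\ge-1$, $B_n=0$ for $n<-1$. The maps $\partial_i$ are extended linearly to endomorphisms of $B$, with $\partial_i|_{B_n}=0$ for $i>n$ (and $\partial|_{B_{-1}}=0$). *)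

theory Defs
  imports "HOL-Algebra.Free_Abelian_Groups"
begin

section \<open>Groupoids\<close>

text \<open>Composition is written in diagrammatic order: \<open>cmp G x y\<close> is the composite \<open>xy\<close>, which is
  meaningful when \<open>cod x = dom y\<close>. Values of the operations outside the carriers are irrelevant.\<close>

record ('o, 'a) groupoid_data =
  Ob :: "'o set"
  Mor :: "'a set"
  dm :: "'a \<Rightarrow> 'o"
  cd :: "'a \<Rightarrow> 'o"
  cmp :: "'a \<Rightarrow> 'a \<Rightarrow> 'a"
  idt :: "'o \<Rightarrow> 'a"

definition is_inverse :: "('o, 'a, 'm) groupoid_data_scheme \<Rightarrow> 'a \<Rightarrow> 'a \<Rightarrow> bool" where
  "is_inverse G x y \<longleftrightarrow> y \<in> Mor G \<and> dm G y = cd G x \<and> cd G y = dm G x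
     \<and> cmp G x y = idt G (dm G x) \<and> cmp G y x = idt G (cd G x)"

locale groupoid =
  fixes G :: "('o, 'a, 'm) groupoid_data_scheme"
  assumes dm_closed: "x \<in> Mor G \<Longrightarrow> dm G x \<in> Ob G"
    and cd_closed: "x \<in> Mor G \<Longrightarrow> cd G x \<in> Ob G"
    and idt_closed: "A \<in> Ob G \<Longrightarrow> idt G A \<in> Mor G"
    and dm_idt: "A \<in> Ob G \<Longrightarrow> dm G (idt G A) = A"
    and cd_idt: "A \<in> Ob G \<Longrightarrow> cd G (idt G A) = A"
    and cmp_closed: "\<lbrakk>x \<in> Mor G; y \<in> Mor G; cd G x = dm G y\<rbrakk> \<Longrightarrow> cmp G x y \<in> Mor G"
    and dm_cmp: "\<lbrakk>x \<in> Mor G; y \<in> Mor G; cd G x = dm G y\<rbrakk> \<Longrightarrow> dm G (cmp G x y) = dm G x"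
    and cd_cmp: "\<lbrakk>x \<in> Mor G; y \<in> Mor G; cd G x = dm G y\<rbrakk> \<Longrightarrow> cd G (cmp G x y) = cd G y"
    and cmp_assoc: "\<lbrakk>x \<in> Mor G; y \<in> Mor G; z \<in> Mor G; cd G x = dm G y; cd G y = dm G z\<rbrakk>
        \<Longrightarrow> cmp G (cmp G x y) z = cmp G x (cmp G y z)"
    and idt_left: "x \<in> Mor G \<Longrightarrow> cmp G (idt G (dm G x)) x = x"
    and idt_right: "x \<in> Mor G \<Longrightarrow> cmp G x (idt G (cd G x)) = x"
    and inverse_exists: "x \<in> Mor G \<Longrightarrow> \<exists>y. is_inverse G x y"

definition invm :: "('o, 'a, 'm) groupoid_data_scheme \<Rightarrow> 'a \<Rightarrow> 'a" where
  "invm G x = (THE y. is_inverse G x y)"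

lemma (in groupoid) is_inverse_unique:
  assumes "x \<in> Mor G" "is_inverse G x y" "is_inverse G x z"
  shows "y = z"
proof -
  have "y = cmp G y (cmp G x z)"
    using assms idt_right[of y] by (simp add: is_inverse_def)
  also have "\<dots> = cmp G (cmp G y x) z"
    using assms cmp_assoc[of y x z] by (simp add: is_inverse_def)
  also have "\<dots> = z"
    using assms idt_left[of z] by (simp add: is_inverse_def)
  finally show ?thesis .
qed

lemma (in groupoid) is_inverse_invm:
  assumes "x \<in> Mor G" shows "is_inverse G x (invm G x)"
  unfolding invm_def using inverse_exists[OF assms] is_inverse_unique[OF assms]
  by (metis theI)

text \<open>The subgroupoid generated by a set \<open>S\<close>. Identities occur only at objects touched by \<open>S\<close>, so
  that a set generating the whole groupoid meets every object.\<close>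

inductive_set generated :: "('o, 'a, 'm) groupoid_data_scheme \<Rightarrow> 'a set \<Rightarrow> 'a set"
  for G S where
    gen_base: "x \<in> S \<Longrightarrow> x \<in> generated G S"
  | gen_inv: "x \<in> generated G S \<Longrightarrow> invm G x \<in> generated G S"
  | gen_cmp: "\<lbrakk>x \<in> generated G S; y \<in> generated G S; cd G x = dm G y\<rbrakk>
      \<Longrightarrow> cmp G x y \<in> generated G S"

text \<open>The connected component of an object, as a set of objects.\<close>

definition component :: "('o, 'a, 'm) groupoid_data_scheme \<Rightarrow> 'o \<Rightarrow> 'o set" where
  "component G A = {B \<in> Ob G. \<exists>x \<in> Mor G. dm G x = A \<and> cd G x = B}"


section \<open>\<open>\<Delta>\<close>-groupoids\<close>

record ('o, 'a) delta_data = "('o, 'a) groupoid_data" +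
  gens :: "'a set"
  jmap :: "'a \<Rightarrow> 'a"

definition kmap :: "('o, 'a, 'm) delta_data_scheme \<Rightarrow> 'a \<Rightarrow> 'a" where
  "kmap G x = invm G (jmap G (invm G x))"

definition H_composable :: "('o, 'a, 'm) delta_data_scheme \<Rightarrow> 'a \<Rightarrow> 'a \<Rightarrow> bool" where
  "H_composable G x y \<longleftrightarrow>
     x \<in> gens G \<and> y \<in> gens G \<and> cd G x = dm G y \<and> cmp G x y \<in> gens G"

locale delta_groupoid = groupoid G
  for G :: "('o, 'a, 'm) delta_data_scheme" +
  assumes gens_subset: "gens G \<subseteq> Mor G"
    and gens_generate: "generated G (gens G) = Mor G"
    and j_closed: "x \<in> gens G \<Longrightarrow> jmap G x \<in> gens G"
    and j_involution: "x \<in> gens G \<Longrightarrow> jmap G (jmap G x) = x"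
    and inv_gens: "invm G ` gens G = gens G"
    and braid: "x \<in> gens G \<Longrightarrow>
        invm G (jmap G (invm G x)) = jmap G (invm G (jmap G x))"
    and k_j_composable: "\<lbrakk>x \<in> gens G; y \<in> gens G; cd G x = dm G y\<rbrakk>
        \<Longrightarrow> cd G (kmap G x) = dm G (jmap G y)"
    and k_j_H_composable: "H_composable G x y \<Longrightarrow> H_composable G (kmap G x) (jmap G y)"
    and k_cmp: "H_composable G x y \<Longrightarrow>
        cmp G (kmap G (cmp G x y)) (invm G (kmap G y)) = kmap G (cmp G (kmap G x) (jmap G y))"

definition dual_ob :: "('o, 'a, 'm) delta_data_scheme \<Rightarrow> 'o \<Rightarrow> 'o" where
  "dual_ob G A = dm G (jmap G (SOME x. x \<in> gens G \<and> dm G x = A))"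

lemma (in delta_groupoid) dual_ob_eq:
  assumes "x \<in> gens G" shows "dual_ob G (dm G x) = dm G (jmap G x)"
proof -
  define x' where "x' = (SOME z. z \<in> gens G \<and> dm G z = dm G x)"
  have x': "x' \<in> gens G" "dm G x' = dm G x"
    unfolding x'_def using someI_ex[of "\<lambda>z. z \<in> gens G \<and> dm G z = dm G x"] assms by blast+
  let ?u = "invm G x'"
  have u: "?u \<in> gens G" using x' inv_gens by blast
  have "x' \<in> Mor G" using x' gens_subset by blast
  then have cu: "cd G ?u = dm G x'" using is_inverse_invm[of x'] by (simp add: is_inverse_def)
  have "cd G (kmap G ?u) = dm G (jmap G x')"
    by (rule k_j_composable[OF u x'(1) cu])
  moreover have "cd G (kmap G ?u) = dm G (jmap G x)"
    using cu x' by (intro k_j_composable[OF u assms]) simp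
  ultimately show ?thesis unfolding dual_ob_def x'_def by simp
qed

text \<open>The operation \<open>x * y\<close>, used for \<open>H\<close>-composable pairs.\<close>

definition star_op :: "('o, 'a, 'm) delta_data_scheme \<Rightarrow> 'a \<Rightarrow> 'a \<Rightarrow> 'a" where
  "star_op G x y = jmap G (cmp G (kmap G x) (jmap G y))"


section \<open>Cells and face maps\<close>

text \<open>The disjoint union of the sets \<open>V\<^sub>n\<close> lives in one type: a tuple \<open>(x\<^sub>1, \<dots>, x\<^sub>n)\<close>, of degree
  \<open>n + 1\<close>, is a list of length \<open>n \<ge> 1\<close>, with elements of \<open>V\<^sub>2 = H\<close> being lists of length one.\<close>

datatype ('o, 'a) cell =
  Point
| Comp "'o set"
| Obj 'o
| Tuple "'a list"

fun cell_degree :: "('o, 'a) cell \<Rightarrow> int" where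
  "cell_degree Point = - 1"
| "cell_degree (Comp C) = 0"
| "cell_degree (Obj A) = 1"
| "cell_degree (Tuple xs) = int (length xs) + 1"

text \<open>The product \<open>x\<^sub>1 x\<^sub>2 \<cdots> x\<^sub>i\<close> for \<open>1 \<le> i \<le> n\<close>.\<close>

definition prefix_product :: "('o, 'a, 'm) groupoid_data_scheme \<Rightarrow> 'a list \<Rightarrow> nat \<Rightarrow> 'a" where
  "prefix_product G xs i = foldl (cmp G) (hd xs) (take (i - 1) (tl xs))"

text \<open>The face maps on tuples of length \<open>n \<ge> 2\<close>, for \<open>0 \<le> i \<le> n + 1\<close>. List positions start
  from \<open>0\<close>, so \<open>x\<^sub>i\<close> is \<open>xs ! (i - 1)\<close>.\<close>

definition tuple_face :: "('o, 'a, 'm) delta_data_scheme \<Rightarrow> nat \<Rightarrow> 'a list \<Rightarrow> 'a list" where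
  "tuple_face G i xs =
     (if i = 0 then map (\<lambda>m. star_op G (prefix_product G xs m) (xs ! m)) [1..<length xs]
      else if i = 1 then tl xs
      else if i \<le> length xs
        then take (i - 2) xs @ [cmp G (xs ! (i - 2)) (xs ! (i - 1))] @ drop i xs
      else butlast xs)"

text \<open>\<open>tuples G n\<close> is the set \<open>V\<^sub>n\<^sub>+\<^sub>1\<close> for \<open>n \<ge> 1\<close>.\<close>

fun tuples :: "('o, 'a, 'm) delta_data_scheme \<Rightarrow> nat \<Rightarrow> 'a list set" where
  "tuples G 0 = {}"
| "tuples G (Suc 0) = {[x] | x. x \<in> gens G}"
| "tuples G (Suc (Suc 0)) = {[x, y] | x y. H_composable G x y}"
| "tuples G (Suc (Suc (Suc n))) =
     {xs. length xs = Suc (Suc (Suc n)) \<and> set xs \<subseteq> gens G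
        \<and> (\<forall>m. Suc m < length xs \<longrightarrow> H_composable G (xs ! m) (xs ! Suc m))
        \<and> (\<forall>i \<in> {1..length xs + 1}. tuple_face G i xs \<in> tuples G (Suc (Suc n)))}"

definition V :: "('o, 'a, 'm) delta_data_scheme \<Rightarrow> int \<Rightarrow> ('o, 'a) cell set" where
  "V G n =
     (if n < - 1 then {}
      else if n = - 1 then {Point}
      else if n = 0 then (\<lambda>A. Comp (component G A)) ` Ob G
      else if n = 1 then Obj ` Ob G
      else Tuple ` tuples G (nat (n - 1)))"

text \<open>\<open>face G i\<close> is \<open>\<partial>\<^sub>i\<close> on cells of degree \<open>n \<ge> i\<close>; other values are never used.\<close>

fun face :: "('o, 'a, 'm) delta_data_scheme \<Rightarrow> nat \<Rightarrow> ('o, 'a) cell \<Rightarrow> ('o, 'a) cell" where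
  "face G i Point = Point"
| "face G i (Comp C) = Point"
| "face G i (Obj A) = Comp (component G (if i = 0 then dual_ob G A else A))"
| "face G i (Tuple [x]) =
     Obj (if i = 0 then cd G (jmap G x) else if i = 1 then cd G x else dm G x)"
| "face G i (Tuple xs) = Tuple (tuple_face G i xs)"


section \<open>The chain groups and the differential\<close>

definition B_deg :: "('o, 'a, 'm) delta_data_scheme \<Rightarrow> int \<Rightarrow> (('o, 'a) cell \<Rightarrow>\<^sub>0 int) monoid" where
  "B_deg G n = free_Abelian_group (V G n)"

text \<open>As the \<open>V\<^sub>n\<close> are pairwise disjoint, \<open>\<Oplus>\<^sub>n \<int>V\<^sub>n\<close> is realised as the free abelian group on their union;
  see \<open>B_direct_sum\<close> below.\<close>

definition B_total :: "('o, 'a, 'm) delta_data_scheme \<Rightarrow> (('o, 'a) cell \<Rightarrow>\<^sub>0 int) monoid" where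
  "B_total G = free_Abelian_group (\<Union>n. V G n)"

definition boundary_face ::
    "('o, 'a, 'm) delta_data_scheme \<Rightarrow> nat \<Rightarrow> (('o, 'a) cell \<Rightarrow>\<^sub>0 int) \<Rightarrow> (('o, 'a) cell \<Rightarrow>\<^sub>0 int)" where
  "boundary_face G i =
     frag_extend (\<lambda>c. if int i \<le> cell_degree c then frag_of (face G i c) else 0)"

text \<open>\<open>Sum_any\<close> is the sum over all \<open>i \<ge> 0\<close> of a family that is almost everywhere zero;
  cf. \<open>finite_boundary_face\<close>.\<close>

definition differential ::
    "('o, 'a, 'm) delta_data_scheme \<Rightarrow> (('o, 'a) cell \<Rightarrow>\<^sub>0 int) \<Rightarrow> (('o, 'a) cell \<Rightarrow>\<^sub>0 int)" where
  "differential G b = Sum_any (\<lambda>i. frag_cmul ((- 1) ^ i) (boundary_face G i b))"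

definition grading :: "(('o, 'a) cell \<Rightarrow>\<^sub>0 int) \<Rightarrow> (('o, 'a) cell \<Rightarrow>\<^sub>0 int)" where
  "grading = frag_extend (\<lambda>c. frag_cmul (cell_degree c) (frag_of c))"

lemma finite_boundary_face: "finite {i. boundary_face G i b \<noteq> 0}"
proof (rule finite_subset)
  show "{i. boundary_face G i b \<noteq> 0} \<subseteq> (\<Union>c \<in> Poly_Mapping.keys b. {i. int i \<le> cell_degree c})"
  proof (rule subsetI, rule ccontr)
    fix i
    assume i: "i \<in> {i. boundary_face G i b \<noteq> 0}"
      and n: "i \<notin> (\<Union>c \<in> Poly_Mapping.keys b. {i. int i \<le> cell_degree c})"
    then have "boundary_face G i b = 0"
      unfolding boundary_face_def by (intro frag_extend_eq_0) auto
    with i show False by simp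
  qed
  have "finite {i. int i \<le> d}" for d
    by (rule finite_subset[of _ "{..nat d}"]) auto
  then show "finite (\<Union>c \<in> Poly_Mapping.keys b. {i. int i \<le> cell_degree c})"
    by simp
qed

lemma tuples_length: "xs \<in> tuples G n \<Longrightarrow> length xs = n \<and> n > 0"
  by (cases "(G, n)" rule: tuples.cases) auto

lemma V_cell_degree: "c \<in> V G n \<Longrightarrow> cell_degree c = n"
  by (auto simp: V_def split: if_splits dest!: tuples_length)

lemma B_direct_sum:
  "(\<lambda>f. sum' f UNIV) \<in> iso (sum_group UNIV (B_deg G)) (B_total G)"
proof -
  have "pairwise (\<lambda>m n. disjnt (V G m) (V G n)) UNIV"
    by (auto simp: pairwise_def disjnt_iff dest: V_cell_degree)
  from iso_free_Abelian_group_sum[OF this] show ?thesis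
    by (simp add: B_deg_def[abs_def] B_total_def)
qed


section \<open>Chain complexes\<close>

text \<open>A chain complex presented as one abelian group \<open>C\<close>, the internal direct sum of subgroups
  \<open>Cn n\<close> indexed by \<open>n \<in> \<int>\<close>, with a differential \<open>d\<close> and the grading operator \<open>p\<close>. The notation
  for \<open>C\<close> is multiplicative, as always for groups in \<open>HOL-Algebra\<close>: \<open>\<one>\<close> is the zero element and
  \<open>x [^] n\<close> is the multiple \<open>n x\<close>.\<close>

locale graded_chain_complex = comm_group C
  for C :: "('c, 'm) monoid_scheme" (structure) +
  fixes Cn :: "int \<Rightarrow> 'c set" and d p :: "'c \<Rightarrow> 'c"
  assumes subgroup_Cn: "subgroup (Cn n) C"
    and direct_sum: "(\<lambda>f. finprod C f {n. f n \<noteq> \<one>})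
        \<in> iso (sum_group UNIV (\<lambda>n. C\<lparr>carrier := Cn n\<rparr>)) C"
    and d_hom: "d \<in> hom C C"
    and d_degree: "d ` Cn n \<subseteq> Cn (n - 1)"
    and d_squared: "x \<in> carrier C \<Longrightarrow> d (d x) = \<one>"
    and p_hom: "p \<in> hom C C"
    and p_eigen: "x \<in> Cn n \<Longrightarrow> p x = x [^] n"

end

theory Submission
  imports Defs
begin

text \<open>A tuple \<open>(x\<^sub>1, \<dots>, x\<^sub>n)\<close> is a simplex with vertices \<open>0, \<dots>, n\<close> and edges
  \<open>h a b = x\<^sub>a\<^sub>+\<^sub>1 \<cdots> x\<^sub>b\<close>, and \<open>\<partial>\<^sub>i\<^sub>+\<^sub>1\<close> omits the vertex \<open>i\<close>. By the formula
  \<open>x * y = i (j x) j (x y)\<close> the face \<open>\<partial>\<^sub>0\<close> has the edges \<open>i (j (h 0 a)) j (h 0 b)\<close> on the vertices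
  \<open>1, \<dots>, n\<close>, so it commutes with the omission of a vertex other than \<open>0\<close>, while
  \<open>j (x * y) = k x j y\<close> yields \<open>\<partial>\<^sub>0 \<partial>\<^sub>0 = \<partial>\<^sub>0 \<partial>\<^sub>1\<close>. Hence the simplicial identities
  \<open>\<partial>\<^sub>j \<partial>\<^sub>i = \<partial>\<^sub>i\<^sub>-\<^sub>1 \<partial>\<^sub>j\<close> hold for \<open>j < i\<close>, and the terms of \<open>\<partial>\<^sup>2\<close> cancel in pairs.\<close>

section \<open>Identities in groupoids\<close>

context groupoid
begin

lemma invm_closed: "x \<in> Mor G \<Longrightarrow> invm G x \<in> Mor G"
  and dm_invm: "x \<in> Mor G \<Longrightarrow> dm G (invm G x) = cd G x"
  and cd_invm: "x \<in> Mor G \<Longrightarrow> cd G (invm G x) = dm G x"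
  and cmp_invm_right: "x \<in> Mor G \<Longrightarrow> cmp G x (invm G x) = idt G (dm G x)"
  and cmp_invm_left: "x \<in> Mor G \<Longrightarrow> cmp G (invm G x) x = idt G (cd G x)"
  using is_inverse_invm[of x] by (auto simp: is_inverse_def)

lemma invm_eqI: "x \<in> Mor G \<Longrightarrow> is_inverse G x y \<Longrightarrow> invm G x = y"
  using is_inverse_unique is_inverse_invm by blast

lemma invm_invm: "x \<in> Mor G \<Longrightarrow> invm G (invm G x) = x"
  by (rule invm_eqI)
    (simp_all add: is_inverse_def invm_closed dm_invm cd_invm cmp_invm_right cmp_invm_left)

lemma cmp_invm_cancel_left:
  assumes "x \<in> Mor G" "y \<in> Mor G" "cd G x = dm G y"
  shows "cmp G (invm G x) (cmp G x y) = y"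
  using assms cmp_assoc[of "invm G x" x y] idt_left[of y]
  by (simp add: invm_closed cd_invm cmp_invm_left)

lemma cmp_invm_cancel_right:
  assumes "x \<in> Mor G" "y \<in> Mor G" "dm G x = dm G y"
  shows "cmp G x (cmp G (invm G x) y) = y"
  using assms cmp_assoc[of x "invm G x" y] idt_left[of y]
  by (simp add: invm_closed cd_invm dm_invm cmp_invm_right)

lemma invm_cmp:
  assumes "x \<in> Mor G" "y \<in> Mor G" "cd G x = dm G y"
  shows "invm G (cmp G x y) = cmp G (invm G y) (invm G x)"
proof (rule invm_eqI)
  show "cmp G x y \<in> Mor G" using assms by (rule cmp_closed)
  have "cmp G (cmp G x y) (cmp G (invm G y) (invm G x)) = idt G (dm G x)"
    using assms by (simp add: cmp_assoc cmp_closed cmp_invm_cancel_right invm_closed dm_invm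
        cd_invm dm_cmp cd_cmp cmp_invm_right)
  moreover have "cmp G (cmp G (invm G y) (invm G x)) (cmp G x y) = idt G (cd G y)"
    using assms by (simp add: cmp_assoc cmp_closed cmp_invm_cancel_left invm_closed dm_invm
        cd_invm dm_cmp cd_cmp cmp_invm_left)
  ultimately show "is_inverse G (cmp G x y) (cmp G (invm G y) (invm G x))"
    using assms by (simp add: is_inverse_def cmp_closed invm_closed dm_invm cd_invm dm_cmp cd_cmp)
qed

text \<open>This composes consecutive edges of \<open>cone_face\<close>: the middle factors
  cancel.\<close>

lemma cmp_invm_telescope:
  assumes "x \<in> Mor G" "y \<in> Mor G" "z \<in> Mor G" "dm G x = dm G y" "dm G y = dm G z"
  shows "cmp G (cmp G (invm G x) y) (cmp G (invm G y) z) = cmp G (invm G x) z"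
  using assms by (simp add: cmp_assoc cmp_closed cmp_invm_cancel_right invm_closed dm_invm
      cd_invm dm_cmp cd_cmp)

text \<open>Composing with the inverse of a morphism turns arrows out of its domain into arrows out
  of its codomain; the inverse morphism gives the other inclusion.\<close>

lemma component_cd_eq_dm:
  assumes "x \<in> Mor G"
  shows "component G (cd G x) = component G (dm G x)"
proof -
  have sub: "component G (dm G y) \<subseteq> component G (cd G y)" if y: "y \<in> Mor G" for y
  proof
    fix B assume "B \<in> component G (dm G y)"
    then obtain z where z: "z \<in> Mor G" "dm G z = dm G y" "cd G z = B" "B \<in> Ob G"
      by (auto simp: component_def)
    then have "cmp G (invm G y) z \<in> Mor G" "dm G (cmp G (invm G y) z) = cd G y"
      "cd G (cmp G (invm G y) z) = B"
      using y by (simp_all add: cmp_closed dm_cmp cd_cmp invm_closed dm_invm cd_invm)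
    with z show "B \<in> component G (cd G y)" by (auto simp: component_def)
  qed
  show ?thesis
    using sub[OF assms] sub[OF invm_closed[OF assms]] assms by (simp add: dm_invm cd_invm)
qed

end


section \<open>Identities in \<open>\<Delta>\<close>-groupoids\<close>

context delta_groupoid
begin

lemma gens_Mor: "x \<in> gens G \<Longrightarrow> x \<in> Mor G"
  using gens_subset by blast

lemma invm_gens: "x \<in> gens G \<Longrightarrow> invm G x \<in> gens G"
  using inv_gens by blast

lemma kmap_invm: "x \<in> gens G \<Longrightarrow> kmap G (invm G x) = invm G (jmap G x)"
  by (simp add: kmap_def invm_invm gens_Mor)

lemma jmap_invm: "x \<in> gens G \<Longrightarrow> jmap G (invm G x) = invm G (kmap G x)"
  by (simp add: kmap_def invm_invm gens_Mor j_closed invm_gens)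

lemma dm_jmap_cong:
  "\<lbrakk>x \<in> gens G; y \<in> gens G; dm G x = dm G y\<rbrakk> \<Longrightarrow> dm G (jmap G x) = dm G (jmap G y)"
  by (metis dual_ob_eq)

lemma H_composable_invm:
  assumes "H_composable G x y"
  shows "H_composable G (invm G y) (invm G x)"
  using assms
  by (auto simp: H_composable_def invm_gens gens_Mor dm_invm cd_invm simp flip: invm_cmp)

text \<open>This is axiom (iv) applied to the pair \<open>(y\<inverse>, x\<inverse>)\<close> and then inverted.\<close>

lemma star_op_eq:
  assumes "H_composable G x y"
  shows "star_op G x y = cmp G (invm G (jmap G x)) (jmap G (cmp G x y))"
proof -
  have g: "x \<in> gens G" "y \<in> gens G" "cd G x = dm G y" "cmp G x y \<in> gens G"
    using assms by (auto simp: H_composable_def)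
  have kj: "kmap G x \<in> gens G" "jmap G y \<in> gens G" "cd G (kmap G x) = dm G (jmap G y)"
      "cmp G (kmap G x) (jmap G y) \<in> gens G"
    using k_j_H_composable[OF assms] by (auto simp: H_composable_def)
  have dj: "dm G (jmap G (cmp G x y)) = dm G (jmap G x)"
    using g by (intro dm_jmap_cong) (simp_all add: dm_cmp gens_Mor)
  have "cmp G (kmap G (cmp G (invm G y) (invm G x))) (invm G (kmap G (invm G x)))
      = kmap G (cmp G (kmap G (invm G y)) (jmap G (invm G x)))"
    by (rule k_cmp[OF H_composable_invm[OF assms]])
  \<comment> \<open>Inversion exchanges j and k by \<open>kmap_invm\<close> and
    \<open>jmap_invm\<close>, so the axiom for the inverted pair returns to x and y.\<close>
  moreover have "cmp G (kmap G (invm G y)) (jmap G (invm G x))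
      = invm G (cmp G (kmap G x) (jmap G y))"
    using g kj by (simp add: kmap_invm jmap_invm invm_cmp gens_Mor)
  moreover have "kmap G (cmp G (invm G y) (invm G x)) = invm G (jmap G (cmp G x y))"
    using g by (simp add: kmap_invm gens_Mor flip: invm_cmp)
  ultimately have "cmp G (invm G (jmap G (cmp G x y))) (jmap G x)
      = invm G (star_op G x y)"
    using g kj by (simp add: kmap_invm star_op_def invm_invm gens_Mor j_closed)
  then have "star_op G x y = invm G (cmp G (invm G (jmap G (cmp G x y))) (jmap G x))"
    using kj by (simp add: star_op_def invm_invm gens_Mor j_closed)
  also have "\<dots> = cmp G (invm G (jmap G x)) (jmap G (cmp G x y))"
    using g dj by (simp add: invm_cmp invm_closed invm_invm gens_Mor j_closed cd_invm)
  finally show ?thesis .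
qed

lemma star_op_closed: "H_composable G x y \<Longrightarrow> star_op G x y \<in> gens G"
  using k_j_H_composable[of x y] by (auto simp: star_op_def H_composable_def j_closed)

lemma jmap_star_op:
  "H_composable G x y \<Longrightarrow> jmap G (star_op G x y) = cmp G (kmap G x) (jmap G y)"
  using k_j_H_composable[of x y] by (auto simp: star_op_def H_composable_def j_involution)

text \<open>The property that both endpoints are domains of generators passes through all rules of
  \<open>generated\<close>; for a generator, its inverse starts at its codomain. The identity of
  \<open>A\<close> then gives the claim.\<close>

lemma gens_meet_objects:
  assumes "A \<in> Ob G"
  obtains x where "x \<in> gens G" "dm G x = A"
proof -
  have "x \<in> Mor G \<and> (\<exists>y\<in>gens G. dm G y = dm G x) \<and> (\<exists>y\<in>gens G. dm G y = cd G x)"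
    if "x \<in> generated G (gens G)" for x
    using that
  proof induction
    case (gen_base x)
    then show ?case by (metis gens_Mor invm_gens dm_invm)
  next
    case (gen_inv x)
    then show ?case by (auto simp: invm_closed dm_invm cd_invm)
  next
    case (gen_cmp x y)
    then show ?case by (auto simp: cmp_closed dm_cmp cd_cmp)
  qed
  then have "\<exists>y\<in>gens G. dm G y = A"
    using idt_closed[OF assms] dm_idt[OF assms] by (metis gens_generate)
  then show ?thesis using that by blast
qed

lemma dual_ob_closed:
  assumes "A \<in> Ob G"
  shows "dual_ob G A \<in> Ob G"
proof -
  obtain x where "x \<in> gens G" "dm G x = A"
    using assms by (rule gens_meet_objects)
  then show ?thesis
    using dual_ob_eq[of x] by (simp add: dm_closed gens_Mor j_closed)
qed

end


section \<open>Tuples as simplices\<close>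

text \<open>A simplex of the nerve of \<open>G\<close> whose edges all lie in \<open>gens G\<close>.
  Values outside a < b, b \<le> n are arbitrary, so faces are later compared through
  \<open>spine\<close>.\<close>

definition simplex :: "('o, 'a, 'm) delta_data_scheme \<Rightarrow> (nat \<Rightarrow> nat \<Rightarrow> 'a) \<Rightarrow> nat \<Rightarrow> bool" where
  "simplex G h n \<longleftrightarrow> (\<forall>a b. a < b \<and> b \<le> n \<longrightarrow> h a b \<in> gens G)
     \<and> (\<forall>a b c. a < b \<and> b < c \<and> c \<le> n \<longrightarrow> cd G (h a b) = dm G (h b c) \<and> cmp G (h a b) (h b c) = h a c)"

definition spine :: "(nat \<Rightarrow> nat \<Rightarrow> 'a) \<Rightarrow> nat \<Rightarrow> 'a list" where
  "spine h n = map (\<lambda>m. h m (Suc m)) [0..<n]"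

text \<open>The coface map: the increasing enumeration of the naturals other than i.\<close>

definition skip :: "nat \<Rightarrow> nat \<Rightarrow> nat" where
  "skip i a = (if a < i then a else Suc a)"

definition omit :: "nat \<Rightarrow> (nat \<Rightarrow> nat \<Rightarrow> 'a) \<Rightarrow> nat \<Rightarrow> nat \<Rightarrow> 'a" where
  "omit i h a b = h (skip i a) (skip i b)"

text \<open>Vertex a of this face is vertex \<open>Suc a\<close> of \<open>h\<close>. Using edges
  out of vertex 0 in place of \<open>star_op\<close> makes \<open>cone_face_omit\<close> an identity
  of functions.\<close>

definition cone_face :: "('o, 'a, 'm) delta_data_scheme \<Rightarrow> (nat \<Rightarrow> nat \<Rightarrow> 'a) \<Rightarrow> nat \<Rightarrow> nat \<Rightarrow> 'a" where
  "cone_face G h a b = cmp G (invm G (jmap G (h 0 (Suc a)))) (jmap G (h 0 (Suc b)))"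

text \<open>These products become the edges of the simplex recovered from a tuple in
  \<open>tuples_obtain_simplex\<close>.\<close>

definition consecutive_product ::
    "('o, 'a, 'm) groupoid_data_scheme \<Rightarrow> 'a list \<Rightarrow> nat \<Rightarrow> nat \<Rightarrow> 'a" where
  "consecutive_product G xs a b = foldl (\<lambda>w m. cmp G w (xs ! m)) (xs ! a) [Suc a..<b]"

lemma length_spine [simp]: "length (spine h n) = n"
  by (simp add: spine_def)

lemma nth_spine [simp]: "m < n \<Longrightarrow> spine h n ! m = h m (Suc m)"
  by (simp add: spine_def)

lemma spine_cong: "(\<And>m. m < n \<Longrightarrow> h m (Suc m) = h' m (Suc m)) \<Longrightarrow> spine h n = spine h' n"
  by (simp add: spine_def)

lemma spine_1: "spine h (Suc 0) = [h 0 1]"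
  by (simp add: spine_def)

lemma spine_2: "spine h (Suc (Suc 0)) = [h 0 1, h 1 2]"
  by (simp add: spine_def numeral_2_eq_2)

lemma skip_mono: "a < b \<Longrightarrow> skip i a < skip i b"
  by (simp add: skip_def)

lemma skip_le: "b \<le> n \<Longrightarrow> skip i b \<le> Suc n"
  by (simp add: skip_def)

text \<open>Dual to the coface identity: for j < i, \<open>skip i\<close> after
  \<open>skip j\<close> equals \<open>skip j\<close> after \<open>skip (i - 1)\<close>.\<close>

lemma omit_omit: "j < i \<Longrightarrow> omit j (omit i h) = omit (i - 1) (omit j h)"
  by (auto simp: omit_def skip_def fun_eq_iff)

text \<open>\<open>skip (Suc i)\<close> fixes the apex 0 and sends \<open>Suc a\<close> to
  \<open>Suc (skip i a)\<close>.\<close>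

lemma cone_face_omit: "cone_face G (omit (Suc i) h) = omit i (cone_face G h)"
  by (simp add: cone_face_def omit_def skip_def fun_eq_iff)

lemma simplex_gens: "\<lbrakk>simplex G h n; a < b; b \<le> n\<rbrakk> \<Longrightarrow> h a b \<in> gens G"
  by (simp add: simplex_def)

lemma simplex_cd: "\<lbrakk>simplex G h n; a < b; b < c; c \<le> n\<rbrakk> \<Longrightarrow> cd G (h a b) = dm G (h b c)"
  by (simp add: simplex_def)

lemma simplex_cmp: "\<lbrakk>simplex G h n; a < b; b < c; c \<le> n\<rbrakk> \<Longrightarrow> cmp G (h a b) (h b c) = h a c"
  by (simp add: simplex_def)

lemma simplex_H_composable:
  "\<lbrakk>simplex G h n; a < b; b < c; c \<le> n\<rbrakk> \<Longrightarrow> H_composable G (h a b) (h b c)"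
  by (simp add: H_composable_def simplex_def)

lemma simplex_omit: "simplex G h (Suc n) \<Longrightarrow> simplex G (omit i h) n"
  unfolding simplex_def omit_def by (meson skip_mono skip_le)

section \<open>Products of consecutive entries of a list\<close>

lemma consecutive_product_Suc: "consecutive_product G xs a (Suc a) = xs ! a"
  by (simp add: consecutive_product_def)

lemma consecutive_product_step:
  "a < b \<Longrightarrow> consecutive_product G xs a (Suc b) = cmp G (consecutive_product G xs a b) (xs ! b)"
  by (simp add: consecutive_product_def)

text \<open>This and \<open>consecutive_product_merge\<close> read products in a tuple off its faces
  1 and 2, for the induction in \<open>consecutive_product_gens\<close>.\<close>

lemma consecutive_product_tl:
  assumes "a < b" "b < length xs"
  shows "consecutive_product G (tl xs) a b = consecutive_product G xs (Suc a) (Suc b)"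
proof -
  have "Suc a \<le> b" using assms by simp
  then show ?thesis using assms(2)
    by (induction b rule: dec_induct)
      (simp_all add: consecutive_product_Suc consecutive_product_step nth_tl)
qed

lemma consecutive_product_merge:
  assumes "1 \<le> b" "b < length (x # y # xs)"
  shows "consecutive_product G (cmp G x y # xs) 0 b = consecutive_product G (x # y # xs) 0 (Suc b)"
  using assms
proof (induction b rule: dec_induct)
  case base
  then show ?case
    by (simp add: consecutive_product_Suc consecutive_product_step
        consecutive_product_Suc[of _ _ 0, simplified])
next
  case (step b)
  then show ?case
    by (cases b) (simp_all add: consecutive_product_step)
qed

lemma prefix_product_eq:
  assumes "1 \<le> m" "m \<le> length xs"
  shows "prefix_product G xs m = consecutive_product G xs 0 m"
  using assms
proof (induction m rule: dec_induct)
  case base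
  then show ?case
    by (cases xs) (simp_all add: prefix_product_def consecutive_product_def)
next
  case (step m)
  then obtain k where k: "m = Suc k" by (cases m) auto
  have "take m (tl xs) = take (m - 1) (tl xs) @ [xs ! m]"
    using step.hyps step.prems k by (simp add: take_Suc_conv_app_nth nth_tl)
  then show ?case
    using step by (simp add: prefix_product_def consecutive_product_step)
qed

lemma consecutive_product_spine:
  assumes "simplex G h n" "a < b" "b \<le> n"
  shows "consecutive_product G (spine h n) a b = h a b"
proof -
  have "Suc a \<le> b" using assms by simp
  then show ?thesis using assms(3)
  proof (induction b rule: dec_induct)
    case base
    then show ?case by (simp add: consecutive_product_Suc)
  next
    case (step b)
    then show ?case
      using simplex_cmp[OF assms(1), of a b "Suc b"] by (simp add: consecutive_product_step)
  qed
qed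

lemma (in groupoid) consecutive_product_cmp:
  assumes xs: "\<And>m. m < length xs \<Longrightarrow> xs ! m \<in> Mor G"
    and comp: "\<And>m. Suc m < length xs \<Longrightarrow> cd G (xs ! m) = dm G (xs ! Suc m)"
    and abc: "a < b" "b < c" "c \<le> length xs"
  shows "cd G (consecutive_product G xs a b) = dm G (consecutive_product G xs b c)"
    and "cmp G (consecutive_product G xs a b) (consecutive_product G xs b c)
      = consecutive_product G xs a c"
proof -
  have prod: "consecutive_product G xs a b \<in> Mor G
      \<and> dm G (consecutive_product G xs a b) = dm G (xs ! a)
      \<and> cd G (consecutive_product G xs a b) = cd G (xs ! (b - 1))"
    if "Suc a \<le> b" "b \<le> length xs" for a b
    using that
  proof (induction b rule: dec_induct)
    case base
    then show ?case by (simp add: consecutive_product_Suc xs)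
  next
    case (step b)
    moreover have "cd G (xs ! (b - 1)) = dm G (xs ! b)"
      using comp[of "b - 1"] step by simp
    ultimately show ?case
      by (simp add: consecutive_product_step cmp_closed dm_cmp cd_cmp xs)
  qed
  show cd_dm: "cd G (consecutive_product G xs a b) = dm G (consecutive_product G xs b c)"
    using prod[of a b] prod[of b c] abc comp[of "b - 1"] by simp
  have "Suc b \<le> c" using abc by simp
  then show "cmp G (consecutive_product G xs a b) (consecutive_product G xs b c)
      = consecutive_product G xs a c"
    using abc(3)
  proof (induction c rule: dec_induct)
    case base
    then show ?case using abc by (simp add: consecutive_product_Suc consecutive_product_step)
  next
    case (step c)
    have ab: "consecutive_product G xs a b \<in> Mor G"
      "cd G (consecutive_product G xs a b) = cd G (xs ! (b - 1))"
      using prod[of a b] abc by auto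
    have bc: "consecutive_product G xs b c \<in> Mor G"
      "dm G (consecutive_product G xs b c) = dm G (xs ! b)"
      "cd G (consecutive_product G xs b c) = cd G (xs ! (c - 1))"
      using prod[of b c] step by auto
    have "cd G (xs ! (b - 1)) = dm G (xs ! b)" "cd G (xs ! (c - 1)) = dm G (xs ! c)"
      using comp[of "b - 1"] comp[of "c - 1"] abc step by simp_all
    with ab bc step abc show ?case
      using cmp_assoc[of "consecutive_product G xs a b" "consecutive_product G xs b c" "xs ! c"]
      by (simp add: consecutive_product_step xs)
  qed
qed


section \<open>Faces of simplices\<close>

context delta_groupoid
begin

lemma cone_face_eq_star_op:
  assumes "simplex G h (Suc n)" "a < b" "b \<le> n"
  shows "cone_face G h a b = star_op G (h 0 (Suc a)) (h (Suc a) (Suc b))"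
  using assms simplex_H_composable[OF assms(1), of 0 "Suc a" "Suc b"]
    simplex_cmp[OF assms(1), of 0 "Suc a" "Suc b"]
  by (simp add: cone_face_def star_op_eq)

text \<open>The edges are star products, hence generators. All edges out of vertex 0 share their
  domain, so their images under j do too, and the products telescope.\<close>

lemma simplex_cone_face:
  assumes "simplex G h (Suc n)"
  shows "simplex G (cone_face G h) n"
proof -
  have gens: "cone_face G h a b \<in> gens G" if "a < b" "b \<le> n" for a b
    using cone_face_eq_star_op[OF assms that] that
      star_op_closed[OF simplex_H_composable[OF assms, of 0 "Suc a" "Suc b"]] by simp
  have h: "h 0 (Suc a) \<in> gens G" if "a \<le> n" for a
    using simplex_gens[OF assms, of 0 "Suc a"] that by simp
  have dm1: "dm G (h 0 (Suc a)) = dm G (h 0 1)" if "a \<le> n" for a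
  proof (cases "a = 0")
    case False
    then have "h 0 1 \<in> Mor G" "h 1 (Suc a) \<in> Mor G" "cd G (h 0 1) = dm G (h 1 (Suc a))"
      "cmp G (h 0 1) (h 1 (Suc a)) = h 0 (Suc a)"
      using that simplex_gens[OF assms, of 0 1] simplex_gens[OF assms, of 1 "Suc a"]
        simplex_cd[OF assms, of 0 1 "Suc a"] simplex_cmp[OF assms, of 0 1 "Suc a"]
      by (auto simp: gens_Mor)
    then show ?thesis using dm_cmp by metis
  qed simp
  have dm: "dm G (jmap G (h 0 (Suc a))) = dm G (jmap G (h 0 (Suc b)))" if "a \<le> n" "b \<le> n" for a b
    using that dm1[of a] dm1[of b] by (intro dm_jmap_cong) (simp_all add: h)
  have jh: "jmap G (h 0 (Suc a)) \<in> Mor G" if "a \<le> n" for a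
    using h[OF that] by (simp add: j_closed gens_Mor)
  have "cd G (cone_face G h a b) = dm G (cone_face G h b c)
      \<and> cmp G (cone_face G h a b) (cone_face G h b c) = cone_face G h a c"
    if "a < b" "b < c" "c \<le> n" for a b c
    using that jh[of a] jh[of b] jh[of c] dm[of a b] dm[of b c] unfolding cone_face_def
    by (simp add: cmp_invm_telescope dm_cmp cd_cmp invm_closed dm_invm cd_invm)
  with gens show ?thesis unfolding simplex_def by blast
qed

text \<open>By j (x * y) = k x j y, the images under j of the edges out of vertex 0 of the cone face
  all start with k of \<open>h 0 1\<close>, which cancels. What remains comes from the edges of
  \<open>h\<close> out of vertex 1, the apex once vertex 0 is omitted.\<close>

lemma cone_face_cone_face:
  assumes "simplex G h (Suc (Suc n))" "a < b" "b \<le> n"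
  shows "cone_face G (cone_face G h) a b = cone_face G (omit 0 h) a b"
proof -
  let ?k = "kmap G (h 0 1)"
  have j: "jmap G (cone_face G h 0 (Suc c)) = cmp G ?k (jmap G (h 1 (Suc (Suc c))))
      \<and> ?k \<in> Mor G \<and> jmap G (h 1 (Suc (Suc c))) \<in> Mor G
      \<and> cd G ?k = dm G (jmap G (h 1 (Suc (Suc c))))" if "c \<le> n" for c
  proof -
    have H: "H_composable G (h 0 1) (h 1 (Suc (Suc c)))"
      using that simplex_H_composable[OF assms(1), of 0 1 "Suc (Suc c)"] by simp
    with k_j_H_composable[OF H] that cone_face_eq_star_op[OF assms(1), of 0 "Suc c"] show ?thesis
      by (auto simp: jmap_star_op H_composable_def gens_Mor)
  qed
  let ?p = "jmap G (h 1 (Suc (Suc a)))" and ?q = "jmap G (h 1 (Suc (Suc b)))"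
  have "cone_face G (cone_face G h) a b = cmp G (invm G (cmp G ?k ?p)) (cmp G ?k ?q)"
    using j[of a] j[of b] assms by (simp add: cone_face_def[of G "cone_face G h"])
  also have "\<dots> = cmp G (invm G ?p) ?q"
    using j[of a] j[of b] assms
    by (simp add: invm_cmp cmp_assoc cmp_closed invm_closed dm_invm cd_invm dm_cmp
        cmp_invm_cancel_left)
  finally show ?thesis by (simp add: cone_face_def omit_def skip_def)
qed

lemma tuple_face_0_spine:
  assumes "simplex G h (Suc n)"
  shows "tuple_face G 0 (spine h (Suc n)) = spine (cone_face G h) n"
proof (rule nth_equalityI)
  fix m assume "m < length (tuple_face G 0 (spine h (Suc n)))"
  then have m: "m < n" by (simp add: tuple_face_def split: if_splits)
  then show "tuple_face G 0 (spine h (Suc n)) ! m = spine (cone_face G h) n ! m"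
    using cone_face_eq_star_op[OF assms, of m "Suc m"] assms
    by (simp add: tuple_face_def prefix_product_eq consecutive_product_spine del: upt_Suc)
qed (simp add: tuple_face_def)

end

text \<open>The remaining branches of \<open>tuple_face\<close> omit the first, an inner or the last
  vertex; at an inner vertex two edges merge into the one that bypasses it.\<close>

lemma tuple_face_Suc_spine:
  assumes "simplex G h (Suc n)" "i \<le> Suc n" "1 \<le> n"
  shows "tuple_face G (Suc i) (spine h (Suc n)) = spine (omit i h) n"
proof -
  consider "i = 0" | "1 \<le> i" "i \<le> n" | "i = Suc n" using assms by linarith
  then show ?thesis
  proof cases
    case 1
    then show ?thesis
      by (intro nth_equalityI) (simp_all add: tuple_face_def nth_tl omit_def skip_def)
  next
    case 2
    then obtain k where k: "i = Suc k" by (cases i) auto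
    have "cmp G (h k (Suc k)) (h (Suc k) (Suc (Suc k))) = h k (Suc (Suc k))"
      using 2 k simplex_cmp[OF assms(1)] by simp
    with 2 k show ?thesis
      by (intro nth_equalityI)
        (auto simp: tuple_face_def nth_append nth_Cons' omit_def skip_def less_Suc_eq_le)
  next
    case 3
    then show ?thesis
      by (intro nth_equalityI) (simp_all add: tuple_face_def nth_butlast omit_def skip_def)
  qed
qed

section \<open>The correspondence between tuples and simplices\<close>

context delta_groupoid
begin

text \<open>The recursive condition in \<open>tuples\<close> concerns faces of index at least 1.
  These are spines of simplices with a vertex omitted, so the induction hypothesis applies.\<close>

lemma spine_in_tuples:
  assumes "simplex G h n" "1 \<le> n"
  shows "spine h n \<in> tuples G n"
  using assms(2,1)
proof (induction n arbitrary: h rule: dec_induct)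
  case base
  then show ?case by (simp add: spine_1 simplex_gens)
next
  case (step n)
  show ?case
  proof (cases "n = 1")
    case True
    then show ?thesis
      using step.prems simplex_H_composable[OF step.prems, of 0 1 2] by (simp add: spine_2)
  next
    case False
    then have "2 \<le> n" using step.hyps by simp
    then obtain k where k: "n = Suc (Suc k)" by (metis add_2_eq_Suc le_Suc_ex)
    have "tuple_face G i (spine h (Suc n)) \<in> tuples G n" if "i \<in> {1..Suc n + 1}" for i
    proof -
      obtain i' where i': "i = Suc i'" "i' \<le> Suc n" using \<open>i \<in> {1..Suc n + 1}\<close> by (cases i) auto
      then show ?thesis
        using step simplex_omit[OF step.prems] by (simp add: tuple_face_Suc_spine)
    qed
    moreover have "set (spine h (Suc n)) \<subseteq> gens G"
      using simplex_gens[OF step.prems] by (auto simp: spine_def)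
    moreover have "H_composable G (spine h (Suc n) ! m) (spine h (Suc n) ! Suc m)"
      if "Suc m < Suc n" for m
      using that simplex_H_composable[OF step.prems] by simp
    ultimately show ?thesis by (simp add: k)
  qed
qed

lemma tuples_H_composable:
  "\<lbrakk>xs \<in> tuples G n; Suc m < n\<rbrakk> \<Longrightarrow> H_composable G (xs ! m) (xs ! Suc m)"
  by (cases "(G, n)" rule: tuples.cases) auto

lemma tuples_gens: "\<lbrakk>xs \<in> tuples G n; m < n\<rbrakk> \<Longrightarrow> xs ! m \<in> gens G"
  by (cases "(G, n)" rule: tuples.cases) (auto simp: H_composable_def less_Suc_eq)

text \<open>The definition of \<open>tuples\<close> speaks directly only of products of two
  neighbours. A block after the first entry survives in face 1; a longer block at the start survives
  in face 2, where its first two entries are merged. Induction on the length covers all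
  blocks.\<close>

lemma consecutive_product_gens:
  assumes "xs \<in> tuples G n" "a < b" "b \<le> n"
  shows "consecutive_product G xs a b \<in> gens G"
  using assms
proof (induction n arbitrary: xs a b)
  case 0
  then show ?case by simp
next
  case (Suc n)
  have len: "length xs = Suc n" using tuples_length[OF Suc.prems(1)] by simp
  show ?case
  proof (cases "b = Suc a")
    case True
    then show ?thesis
      using Suc.prems tuples_gens by (simp add: consecutive_product_Suc)
  next
    case long: False
    show ?thesis
    \<comment> \<open>The clause of \<open>tuples\<close> for pairs has no face condition; there
      \<open>H_composable\<close> gives the product.\<close>
    proof (cases "n = 1")
      case True
      with long Suc.prems have ab: "a = 0" "b = Suc (Suc 0)" by auto
      show ?thesis
        using tuples_H_composable[OF Suc.prems(1), of 0] True
        by (simp add: ab consecutive_product_Suc consecutive_product_step H_composable_def)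
    next
      case False
      then have "2 \<le> n" using long Suc.prems by auto
      then obtain k where k: "n = Suc (Suc k)" by (metis add_2_eq_Suc le_Suc_ex)
      have faces: "tuple_face G i xs \<in> tuples G n" if "1 \<le> i" "i \<le> Suc (Suc n)" for i
        using Suc.prems(1) that len by (simp add: k)
      show ?thesis
      proof (cases a)
        case (Suc a')
        have "tl xs \<in> tuples G n" using faces[of 1] by (simp add: tuple_face_def)
        then show ?thesis
          using Suc.IH[of "tl xs" a' "b - 1"] Suc Suc.prems len
          by (simp add: consecutive_product_tl)
      next
        case 0
        obtain x y ys where xs: "xs = x # y # ys" using len k by (auto simp: length_Suc_conv)
        have "cmp G x y # ys \<in> tuples G n"
          using faces[of 2] len k by (simp add: tuple_face_def xs)
        then show ?thesis
          using Suc.IH[of "cmp G x y # ys" 0 "b - 1"] 0 long Suc.prems len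
            consecutive_product_merge[of "b - 1" x y ys G]
          by (simp add: xs)
      qed
    qed
  qed
qed

text \<open>With \<open>spine_in_tuples\<close> this identifies tuples with spines of simplices, so
  faces can be computed on edges.\<close>

lemma tuples_obtain_simplex:
  assumes "xs \<in> tuples G n"
  obtains h where "simplex G h n" "xs = spine h n"
proof
  let ?h = "consecutive_product G xs"
  have len: "length xs = n" using tuples_length[OF assms] by simp
  have "cd G (?h a b) = dm G (?h b c) \<and> cmp G (?h a b) (?h b c) = ?h a c"
    if "a < b" "b < c" "c \<le> n" for a b c
    using that len consecutive_product_cmp[of xs a b c] tuples_gens[OF assms]
      tuples_H_composable[OF assms] by (auto simp: gens_Mor H_composable_def)
  then show "simplex G ?h n"
    using consecutive_product_gens[OF assms] unfolding simplex_def by blast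
  show "xs = spine ?h n"
    by (rule nth_equalityI) (simp_all add: len consecutive_product_Suc)
qed

end


section \<open>Simplicial identities for cells\<close>

definition simplex_face ::
    "('o, 'a, 'm) delta_data_scheme \<Rightarrow> nat \<Rightarrow> (nat \<Rightarrow> nat \<Rightarrow> 'a) \<Rightarrow> nat \<Rightarrow> nat \<Rightarrow> 'a" where
  "simplex_face G i h = (case i of 0 \<Rightarrow> cone_face G h | Suc i' \<Rightarrow> omit i' h)"

context delta_groupoid
begin

lemma simplex_simplex_face:
  "simplex G h (Suc n) \<Longrightarrow> simplex G (simplex_face G i h) n"
  by (simp add: simplex_face_def simplex_cone_face simplex_omit split: nat.split)

lemma face_spine:
  assumes "simplex G h (Suc (Suc n))" "i \<le> Suc (Suc (Suc n))"
  shows "face G i (Tuple (spine h (Suc (Suc n)))) = Tuple (spine (simplex_face G i h) (Suc n))"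
proof -
  \<comment> \<open>With at least two entries the last equation of \<open>face\<close> applies, not
    the one for singletons.\<close>
  have "face G i (Tuple (spine h (Suc (Suc n)))) = Tuple (tuple_face G i (spine h (Suc (Suc n))))"
    by (simp add: spine_def upt_conv_Cons del: upt_Suc)
  then show ?thesis
    using assms tuple_face_0_spine[OF assms(1)] tuple_face_Suc_spine[OF assms(1)]
    by (simp add: simplex_face_def split: nat.split)
qed

lemma face_spine_1:
  "face G i (Tuple (spine h (Suc 0))) =
     Obj (if i = 0 then cd G (jmap G (h 0 1)) else if i = 1 then cd G (h 0 1) else dm G (h 0 1))"
  by (simp add: spine_1)

text \<open>For j > 0 this is \<open>omit_omit\<close>; for j = 0 it is
  \<open>cone_face_cone_face\<close> if i = 1 and \<open>cone_face_omit\<close> if i > 1. The case i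
  = 1 gives equality only for edges in range, hence the spines.\<close>

lemma simplex_face_simplex_face:
  assumes "simplex G h (Suc (Suc n))" "j < i"
  shows "spine (simplex_face G j (simplex_face G i h)) n
       = spine (simplex_face G (i - 1) (simplex_face G j h)) n"
proof (cases j)
  case (Suc j')
  then obtain i' where "i = Suc (Suc i')" "j' < Suc i'"
    using assms(2) by (metis Suc_less_eq less_imp_Suc_add Suc_lessE)
  then show ?thesis
    using Suc by (simp add: simplex_face_def omit_omit[of j' "Suc i'"])
next
  case 0
  show ?thesis
  proof (cases "i = 1")
    case True
    then show ?thesis
      using 0 cone_face_cone_face[OF assms(1)]
      by (auto simp: simplex_face_def intro!: spine_cong)
  next
    case False
    then obtain i' where "i = Suc (Suc i')"
      using assms(2) 0 by (metis One_nat_def not0_implies_Suc not_less0)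
    then show ?thesis
      using 0 by (simp add: simplex_face_def cone_face_omit)
  qed
qed

lemma V_cases:
  assumes "c \<in> V G n"
  obtains (Point) "n = - 1" "c = Point"
  | (Comp) A where "n = 0" "A \<in> Ob G" "c = Comp (component G A)"
  | (Obj) A where "n = 1" "A \<in> Ob G" "c = Obj A"
  | (Tuple) m h where "n = int m + 2" "simplex G h (Suc m)" "c = Tuple (spine h (Suc m))"
proof (cases "n \<le> 1")
  case True
  then show ?thesis
    using assms Point Comp Obj by (auto simp: V_def split: if_splits)
next
  case False
  define m where "m = nat (n - 2)"
  have m: "n = int m + 2" using False by (simp add: m_def)
  have "c \<in> Tuple ` tuples G (Suc m)"
    using assms m by (auto simp: V_def nat_add_distrib split: if_splits)
  then obtain xs where xs: "c = Tuple xs" "xs \<in> tuples G (Suc m)" by blast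
  obtain h where "simplex G h (Suc m)" "xs = spine h (Suc m)"
    using xs(2) by (rule tuples_obtain_simplex)
  then show ?thesis using Tuple[OF m] xs(1) by simp
qed

lemma spine_in_V: "simplex G h (Suc m) \<Longrightarrow> Tuple (spine h (Suc m)) \<in> V G (int m + 2)"
  using spine_in_tuples[of h "Suc m"] by (auto simp: V_def nat_add_distrib)

lemma face_in_V:
  assumes "c \<in> V G n" "int i \<le> n"
  shows "face G i c \<in> V G (n - 1)"
  using assms(1)
proof (cases rule: V_cases)
  case Point
  then show ?thesis using assms(2) by simp
next
  case (Comp A)
  then show ?thesis by (simp add: V_def)
next
  case (Obj A)
  then show ?thesis by (simp add: V_def dual_ob_closed)
next
  case (Tuple m h)
  show ?thesis
  proof (cases m)
    case 0
    have "h 0 1 \<in> gens G" using simplex_gens[OF Tuple(2), of 0 1] by simp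
    then show ?thesis
      using Tuple 0 by (simp add: face_spine_1 V_def dm_closed cd_closed gens_Mor j_closed)
  next
    case (Suc k)
    then show ?thesis
      using Tuple assms(2) spine_in_V[OF simplex_simplex_face, of h k i]
      by (simp add: face_spine add.commute)
  qed
qed

text \<open>From degree 4 on, double faces are still tuples and the identities for simplices apply.
  In degrees 2 and 3 they are components and objects, and endpoints are compared; below that both
  sides are \<open>Point\<close>.\<close>

lemma face_face:
  assumes "c \<in> V G n" "int i \<le> n" "j < i"
  shows "face G j (face G i c) = face G (i - 1) (face G j c)"
  using assms(1)
proof (cases rule: V_cases)
  case Point
  then show ?thesis by simp
next
  case (Comp A)
  then show ?thesis by simp
next
  case (Obj A)
  then show ?thesis by simp
next
  case (Tuple m h)
  show ?thesis
  proof (cases m)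
    case 0
    obtain x where x: "x \<in> gens G" and c: "c = Tuple [x]"
      using simplex_gens[OF Tuple(2), of 0 1] Tuple(3) by (simp add: 0 spine_1)
    have dual_cd: "dual_ob G (cd G x) = dm G (jmap G (invm G x))"
      using dual_ob_eq[OF invm_gens[OF x]] x by (simp add: dm_invm gens_Mor)
    \<comment> \<open>The braid relation turns j i j into i j i, so this object is the codomain of j
      (i x), whose domain is the object in \<open>dual_cd\<close>. Hence both lie in one
      component.\<close>
    have dual_cd_j: "dual_ob G (cd G (jmap G x)) = cd G (jmap G (invm G x))"
    proof -
      have "dual_ob G (cd G (jmap G x)) = dm G (jmap G (invm G (jmap G x)))"
        using dual_ob_eq[OF invm_gens[OF j_closed[OF x]]] x by (simp add: dm_invm gens_Mor j_closed)
      also have "\<dots> = cd G (jmap G (invm G x))"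
        using x by (simp add: dm_invm gens_Mor j_closed invm_gens flip: braid)
      finally show ?thesis .
    qed
    have "component G (dual_ob G (cd G x)) = component G (dual_ob G (cd G (jmap G x)))"
      unfolding dual_cd dual_cd_j
      using x by (simp add: component_cd_eq_dm gens_Mor j_closed invm_gens)
    moreover have "component G (dual_ob G (dm G x)) = component G (cd G (jmap G x))"
      using x by (simp add: dual_ob_eq component_cd_eq_dm gens_Mor j_closed)
    moreover have "component G (cd G x) = component G (dm G x)"
      using x by (simp add: component_cd_eq_dm gens_Mor)
    moreover have "i = 1 \<and> j = 0 \<or> i = 2 \<and> j = 0 \<or> i = 2 \<and> j = 1"
      using assms(2,3) Tuple(1) 0 by auto
    ultimately show ?thesis by (auto simp: c)
  next
    case (Suc k)
    have h: "simplex G h (Suc (Suc k))" using Tuple(2) Suc by simp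
    have c: "c = Tuple (spine h (Suc (Suc k)))" using Tuple(3) Suc by simp
    have ij: "i \<le> Suc (Suc (Suc k))" "j \<le> Suc (Suc (Suc k))" using assms(2,3) Tuple(1) Suc by auto
    show ?thesis
    proof (cases k)
      case (Suc l)
      have h': "simplex G h (Suc (Suc (Suc l)))" using h Suc by simp
      then have "simplex G (simplex_face G q h) (Suc (Suc l))" for q
        by (rule simplex_simplex_face)
      then show ?thesis
        using simplex_face_simplex_face[OF h' assms(3)] assms(3) ij
        by (simp add: c face_spine h' Suc)
    next
      case 0
      let ?x = "h 0 1" and ?y = "h 1 2"
      have H: "H_composable G ?x ?y" and xy: "cmp G ?x ?y = h 0 2"
        using simplex_H_composable[OF h, of 0 1 2] simplex_cmp[OF h, of 0 1 2] by (simp_all add: 0)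
      have g: "?x \<in> gens G" "?y \<in> gens G" "cd G ?x = dm G ?y" "h 0 2 \<in> gens G"
        using H xy by (auto simp: H_composable_def)
      have kj: "kmap G ?x \<in> gens G" "cd G (kmap G ?x) = dm G (jmap G ?y)"
        using k_j_H_composable[OF H] by (auto simp: H_composable_def)
      have star: "cone_face G h 0 1 = star_op G ?x ?y"
        using cone_face_eq_star_op[of h 1 0 1] h by (simp add: 0 numeral_2_eq_2)
      have dj: "dm G (jmap G ?x) = dm G (jmap G (h 0 2))"
        using g by (intro dm_jmap_cong) (auto simp: dm_cmp gens_Mor simp flip: xy simp del: One_nat_def)
      \<comment> \<open>The double faces are endpoints of x * y, y, xy, x or codomains of their
        images under j. For j (x * y) the product k x j y is used, for x * y itself
        \<open>star_op_eq\<close>.\<close>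
      have "cd G (jmap G (cone_face G h 0 1)) = cd G (jmap G ?y)"
        using g kj by (simp add: star jmap_star_op[OF H] cd_cmp gens_Mor j_closed del: One_nat_def)
      moreover have "cd G (cone_face G h 0 1) = cd G (jmap G (h 0 2))"
        "dm G (cone_face G h 0 1) = cd G (jmap G ?x)"
        using g dj by (simp_all add: star star_op_eq[OF H] xy cd_cmp dm_cmp gens_Mor j_closed
            invm_closed dm_invm cd_invm del: One_nat_def)
      moreover have "cd G (h 0 2) = cd G ?y" "dm G (h 0 2) = dm G ?x"
        using g by (auto simp: cd_cmp dm_cmp gens_Mor simp flip: xy simp del: One_nat_def)
      moreover have "i = 1 \<and> j = 0 \<or> i = 2 \<and> j = 0 \<or> i = 2 \<and> j = 1
          \<or> i = 3 \<and> j = 0 \<or> i = 3 \<and> j = 1 \<or> i = 3 \<and> j = 2"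
        using ij assms(3) 0 by auto
      ultimately show ?thesis
        using g(3) h
        by (auto simp: c 0 face_spine face_spine_1 simplex_face_def omit_def skip_def
            numeral_2_eq_2 numeral_3_eq_3)
    qed
  qed
qed

end


section \<open>The differential\<close>

text \<open>The bound lets i run from 0 to the degree; for \<open>Point\<close> the sum is
  empty.\<close>

definition cell_boundary ::
    "('o, 'a, 'm) delta_data_scheme \<Rightarrow> ('o, 'a) cell \<Rightarrow> (('o, 'a) cell \<Rightarrow>\<^sub>0 int)" where
  "cell_boundary G c =
     (\<Sum>i<nat (cell_degree c + 1). frag_cmul ((- 1) ^ i) (frag_of (face G i c)))"

lemma differential_add: "differential G (a + b) = differential G a + differential G b"
proof -
  have "boundary_face G i (a + b) = boundary_face G i a + boundary_face G i b" for i
    by (simp add: boundary_face_def frag_extend_add)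
  moreover have "finite {i. frag_cmul ((- 1) ^ i) (boundary_face G i b) \<noteq> 0}" for b
    using finite_boundary_face[of G b] by simp
  ultimately show ?thesis
    by (simp add: differential_def frag_cmul_distrib2 Sum_any.distrib)
qed

lemma differential_diff: "differential G (a - b) = differential G a - differential G b"
  using differential_add[of G "a - b" b] by simp

lemma differential_frag_of: "differential G (frag_of c) = cell_boundary G c"
proof -
  let ?g = "\<lambda>i. frag_cmul ((- 1) ^ i) (boundary_face G i (frag_of c))"
  have "differential G (frag_of c) = sum ?g {..<nat (cell_degree c + 1)}"
    unfolding differential_def
  proof (rule Sum_any.expand_superset)
    show "{i. ?g i \<noteq> 0} \<subseteq> {..<nat (cell_degree c + 1)}"
      by (auto simp: boundary_face_def split: if_splits)
  qed simp
  also have "\<dots> = cell_boundary G c"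
    unfolding cell_boundary_def by (intro sum.cong) (auto simp: boundary_face_def)
  finally show ?thesis .
qed

text \<open>Both sides are additive and agree on basis elements; the sum over all i is thus replaced
  by a free extension.\<close>

lemma differential_eq: "differential G b = frag_extend (cell_boundary G) b"
  using subset_UNIV[of "Poly_Mapping.keys b"]
proof (induction b rule: frag_induction)
  case zero
  show ?case using differential_diff[of G 0 0] by simp
next
  case (one c)
  show ?case by (simp add: differential_frag_of)
next
  case (diff a b)
  then show ?case by (simp add: differential_diff frag_extend_diff)
qed

text \<open>The involution \<open>(i, j) \<leftrightarrow> (j, i - 1)\<close> between the terms with \<open>j < i\<close> and those with
  \<open>i \<le> j\<close> reverses the sign.\<close>

lemma alternating_double_sum_eq_0:
  fixes c :: "nat \<Rightarrow> nat \<Rightarrow> ('c \<Rightarrow>\<^sub>0 int)"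
  assumes "\<And>i j. \<lbrakk>j < i; i \<le> n\<rbrakk> \<Longrightarrow> c i j = c j (i - 1)"
  shows "(\<Sum>i<Suc n. \<Sum>j<n. frag_cmul ((- 1) ^ (i + j)) (c i j)) = 0"
proof -
  let ?g = "\<lambda>(i, j). frag_cmul ((- 1) ^ (i + j)) (c i j)"
  let ?L = "{(i, j). j < i \<and> i \<le> n}" and ?U = "{(i, j). i \<le> j \<and> j < n}"
  have sub: "?L \<subseteq> {..<Suc n} \<times> {..<n}" "?U \<subseteq> {..<Suc n} \<times> {..<n}" by auto
  have fin: "finite ?L" "finite ?U"
    using finite_subset[OF sub(1)] finite_subset[OF sub(2)] by simp_all
  have "(\<Sum>i<Suc n. \<Sum>j<n. frag_cmul ((- 1) ^ (i + j)) (c i j)) = sum ?g ({..<Suc n} \<times> {..<n})"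
    by (rule sum.cartesian_product)
  also have "{..<Suc n} \<times> {..<n} = ?L \<union> ?U" by auto
  also have "sum ?g (?L \<union> ?U) = sum ?g ?L + sum ?g ?U"
    by (rule sum.union_disjoint[OF fin]) auto
  also have "sum ?g ?L = (\<Sum>p\<in>?U. - ?g p)"
  proof (rule sum.reindex_bij_witness[where i = "\<lambda>(i, j). (Suc j, i)" and j = "\<lambda>(i, j). (j, i - 1)"
        and S = ?L and T = ?U and g = ?g and h = "\<lambda>p. - ?g p"])
    fix p assume "p \<in> ?L"
    \<comment> \<open>As j < i forces i to be positive, passing to i - 1 really changes the parity
      of the exponent.\<close>
    then obtain i j where p: "p = (Suc i, j)" "j \<le> i" "Suc i \<le> n"
      by (cases p, cases "fst p") auto
    then show "- ?g ((\<lambda>(i, j). (j, i - 1)) p) = ?g p"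
      using assms[of j "Suc i"] by (simp add: add.commute)
  qed auto
  finally show ?thesis by (simp add: sum_negf)
qed

context delta_groupoid
begin

lemma differential_cell_boundary:
  assumes c: "c \<in> V G n"
  shows "differential G (cell_boundary G c) = 0"
proof (cases "n < 0")
  case True
  then have "cell_boundary G c = 0"
    using V_cell_degree[OF c] by (simp add: cell_boundary_def)
  then show ?thesis by (simp add: differential_eq)
next
  case False
  define m where "m = nat n"
  have n: "n = int m" using False by (simp add: m_def)
  have "differential G (cell_boundary G c)
      = (\<Sum>i<Suc m. frag_cmul ((- 1) ^ i) (cell_boundary G (face G i c)))"
    using V_cell_degree[OF c]
    by (simp add: n differential_eq cell_boundary_def[of G c] frag_extend_sum frag_extend_cmul
        nat_add_distrib del: sum.lessThan_Suc)
  also have "\<dots> = (\<Sum>i<Suc m. \<Sum>j<m. frag_cmul ((- 1) ^ (i + j)) (frag_of (face G j (face G i c))))"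
  proof (rule sum.cong)
    fix i assume "i \<in> {..<Suc m}"
    \<comment> \<open>A face of degree m - 1 has exactly m boundary terms.\<close>
    then have "cell_degree (face G i c) = n - 1"
      using face_in_V[OF c, of i] by (intro V_cell_degree) (simp add: n)
    then show "frag_cmul ((- 1) ^ i) (cell_boundary G (face G i c))
        = (\<Sum>j<m. frag_cmul ((- 1) ^ (i + j)) (frag_of (face G j (face G i c))))"
      by (simp add: cell_boundary_def n frag_cmul_sum power_add)
  qed simp
  also have "\<dots> = 0"
    using face_face[OF c] by (intro alternating_double_sum_eq_0) (simp add: n)
  finally show ?thesis .
qed

lemma differential_differential:
  assumes "Poly_Mapping.keys b \<subseteq> (\<Union>n. V G n)"
  shows "differential G (differential G b) = 0"
  using assms
proof (induction b rule: frag_induction)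
  case zero
  show ?case by (simp add: differential_eq)
next
  case (diff x y)
  then show ?case by (simp add: differential_diff)
next
  case (one c)
  then show ?case by (auto simp: differential_frag_of differential_cell_boundary)
qed

lemma keys_differential:
  assumes "Poly_Mapping.keys b \<subseteq> V G n"
  shows "Poly_Mapping.keys (differential G b) \<subseteq> V G (n - 1)"
proof -
  have "Poly_Mapping.keys (cell_boundary G c) \<subseteq> V G (n - 1)" if c: "c \<in> V G n" for c
  proof -
    have "cell_boundary G c \<in> carrier (free_Abelian_group (V G (n - 1)))"
      unfolding cell_boundary_def
    proof (rule sum_closed_free_Abelian_group)
      fix i assume "i \<in> {..<nat (cell_degree c + 1)}"
      then have "face G i c \<in> V G (n - 1)"
        using V_cell_degree[OF c] by (intro face_in_V[OF c]) auto
      then show "frag_cmul ((- 1) ^ i) (frag_of (face G i c))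
          \<in> carrier (free_Abelian_group (V G (n - 1)))"
        by auto
    qed
    then show ?thesis by simp
  qed
  with assms show ?thesis
    unfolding differential_eq using keys_frag_extend[of "cell_boundary G" b] by blast
qed

end

section \<open>The grading operator and the total group\<close>

lemma grading_add: "grading (a + b) = grading a + grading b"
  by (simp add: grading_def frag_extend_add)

lemma keys_grading: "Poly_Mapping.keys (grading b) \<subseteq> Poly_Mapping.keys b"
  unfolding grading_def
  by (rule subset_trans[OF keys_frag_extend]) (auto simp: keys_frag_of dest: subsetD[OF keys_cmul])

lemma grading_homogeneous:
  assumes "Poly_Mapping.keys b \<subseteq> V G n"
  shows "grading b = frag_cmul n b"
  using assms
proof (induction b rule: frag_induction)
  case zero
  show ?case by (simp add: grading_def)
next
  case (diff x y)
  then show ?case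
    using frag_cmul_distrib2[of n "x - y" y]
    by (simp add: grading_def frag_extend_diff algebra_simps)
next
  case (one c)
  then show ?case by (simp add: grading_def V_cell_degree)
qed

text \<open>This translates multiplicative notation into sums; over an infinite set both sides
  default to zero.\<close>

lemma finprod_free_Abelian_group:
  assumes "\<And>i. i \<in> I \<Longrightarrow> Poly_Mapping.keys (f i) \<subseteq> S"
  shows "finprod (free_Abelian_group S) f I = sum f I"
proof -
  interpret comm_group "free_Abelian_group S" by (rule abelian_free_Abelian_group)
  show ?thesis
    using assms by (induction I rule: infinite_finite_induct) (simp_all add: Pi_def)
qed

theorem proposition11:
  fixes G :: "('o, 'a) delta_data"
  assumes "delta_groupoid G"
  shows "graded_chain_complex (B_total G) (\<lambda>n. carrier (B_deg G n)) (differential G) grading"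
proof -
  interpret delta_groupoid G by (rule assms)
  let ?S = "\<Union>n. V G n"
  interpret B: comm_group "B_total G"
    unfolding B_total_def by (rule abelian_free_Abelian_group)
  have V: "V G n \<subseteq> ?S" for n by blast
  \<comment> \<open>The operation of a free abelian group does not depend on its basis, so
    restricting the carrier yields \<open>B_deg G n\<close> itself.\<close>
  have B_deg: "(B_total G)\<lparr>carrier := carrier (B_deg G n)\<rparr> = B_deg G n" for n
    by (simp add: B_total_def B_deg_def free_Abelian_group_def)
  show ?thesis
  proof (intro graded_chain_complex.intro graded_chain_complex_axioms.intro)
    show "comm_group (B_total G)" by (rule B.comm_group_axioms)
  next
    fix n
    show "subgroup (carrier (B_deg G n)) (B_total G)"
    proof (rule B.group_incl_imp_subgroup)
      show "carrier (B_deg G n) \<subseteq> carrier (B_total G)"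
        using V[of n] by (auto simp: B_deg_def B_total_def)
      show "group ((B_total G)\<lparr>carrier := carrier (B_deg G n)\<rparr>)"
        by (simp add: B_deg) (simp add: B_deg_def)
    qed
    show "differential G ` carrier (B_deg G n) \<subseteq> carrier (B_deg G (n - 1))"
      using keys_differential by (simp add: B_deg_def image_subset_iff)
  next
    \<comment> \<open>\<open>sum'\<close> is the sum over the support, so this map agrees with that
      of \<open>B_direct_sum\<close> on the carrier.\<close>
    have "(\<lambda>f. finprod (B_total G) f {n. f n \<noteq> \<one>\<^bsub>B_total G\<^esub>}) \<in> iso (sum_group UNIV (B_deg G)) (B_total G)"
    proof (rule group.iso_eq[OF _ B_direct_sum])
      show "group (sum_group UNIV (B_deg G))"
        by (rule sum_group) (simp add: B_deg_def)
      fix f assume "f \<in> carrier (sum_group UNIV (B_deg G))"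
      then have "Poly_Mapping.keys (f n) \<subseteq> ?S" for n
        using V[of n] by (auto simp: B_deg_def carrier_sum_group PiE_iff)
      then show "finprod (B_total G) f {n. f n \<noteq> \<one>\<^bsub>B_total G\<^esub>} = sum' f UNIV"
        by (simp add: B_total_def finprod_free_Abelian_group sum.G_def)
    qed
    then show "(\<lambda>f. finprod (B_total G) f {n. f n \<noteq> \<one>\<^bsub>B_total G\<^esub>})
        \<in> iso (sum_group UNIV (\<lambda>n. (B_total G)\<lparr>carrier := carrier (B_deg G n)\<rparr>)) (B_total G)"
      by (simp add: B_deg)
  next
    \<comment> \<open>An element of the total group may mix degrees, so closure is reduced to single
      cells, which are homogeneous.\<close>
    have "Poly_Mapping.keys (differential G b) \<subseteq> ?S" if "Poly_Mapping.keys b \<subseteq> ?S" for b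
      using that
    proof (induction b rule: frag_induction)
      case zero
      show ?case by (simp add: differential_eq)
    next
      case (diff x y)
      then show ?case
        using keys_diff[of "differential G x" "differential G y"] by (auto simp: differential_diff)
    next
      case (one c)
      then obtain n where "c \<in> V G n" by blast
      then show ?case using keys_differential[of "frag_of c" n] V[of "n - 1"] by auto
    qed
    then show "differential G \<in> hom (B_total G) (B_total G)"
      by (intro homI) (simp_all add: B_total_def differential_add)
  next
    fix b assume "b \<in> carrier (B_total G)"
    then show "differential G (differential G b) = \<one>\<^bsub>B_total G\<^esub>"
      by (simp add: B_total_def differential_differential)
  next
    show "grading \<in> hom (B_total G) (B_total G)"
      by (intro homI) (auto simp: B_total_def grading_add dest: subsetD[OF keys_grading])
  next
    fix b n assume "b \<in> carrier (B_deg G n)"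
    then show "grading b = b [^]\<^bsub>B_total G\<^esub> n"
      using V[of n] by (auto simp: B_deg_def B_total_def grading_homogeneous)
  qed
qed

end
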